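(* Let each odd vertex of $\mathbb{Z}^2$ be closed with probability $p$ and each even vertex be closed with probability $q$, independently for different vertices. There exists $c_0>0$ such that if $0<p<1$ and $q<c_0\,p^2(\log p^{-1})^{-2}$, then almost surely, from every initial vertex, Trap on the open subgraph of $\mathbb{Z}^2$ is not a draw.
   Context: $\mathbb{Z}^2$ is the square lattice graph, with $u\sim v$ iff $\|u-v\|_1=1$. A vertex is odd or even according to the parity of the sum of its coordinates. Trap: a token starts at an initial vertex of a graph; two players alternately move it along an incident edge to a vertex never visited before (the initial vertex counts as visited). A player who has no possible move loses and the other wins. A strategy is winning for a player if it results in a win for that player whatever strategy the opponent uses; the game is a draw if neither player has a winning strategy. Vertices that are not closed are open; Trap on the open subgraph means moves to closed vertices are forbidden. By convention the game is a first-player win if the initial vertex is closed. The configuration is known to both players. *)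

theory Defs
  imports "HOL-Probability.Probability"
begin

text \<open>
  Trap on the subgraph induced by a vertex set \<open>V\<close> of the graph with adjacency relation \<open>adj\<close>.
  A game position is the list of all vertices visited so far in order of visit, initial vertex
  included. Hence the token is at \<open>last h\<close>, and the first player is to move iff \<open>length h\<close> is odd.
\<close>

definition trap_moves :: "('v \<Rightarrow> 'v \<Rightarrow> bool) \<Rightarrow> 'v set \<Rightarrow> 'v list \<Rightarrow> 'v set" where
  "trap_moves adj V h = {v \<in> V. adj (last h) v \<and> v \<notin> set h}"

text \<open>
  A strategy sees the whole history. Only its values at nonempty lists that admit a move are
  constrained; values at positions that cannot occur in a play, or where the other player is to
  move, are never consulted.
\<close>

definition trap_strategy :: "('v \<Rightarrow> 'v \<Rightarrow> bool) \<Rightarrow> 'v set \<Rightarrow> ('v list \<Rightarrow> 'v) \<Rightarrow> bool" where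
  "trap_strategy adj V \<sigma> \<longleftrightarrow>
     (\<forall>h. h \<noteq> [] \<and> trap_moves adj V h \<noteq> {} \<longrightarrow> \<sigma> h \<in> trap_moves adj V h)"

text \<open>The position after \<open>n\<close> moves, constant from the moment the player to move is stuck.\<close>

primrec trap_play ::
  "('v \<Rightarrow> 'v \<Rightarrow> bool) \<Rightarrow> 'v set \<Rightarrow> 'v \<Rightarrow> ('v list \<Rightarrow> 'v) \<Rightarrow> ('v list \<Rightarrow> 'v) \<Rightarrow> nat \<Rightarrow> 'v list" where
  "trap_play adj V x \<sigma> \<tau> 0 = [x]"
| "trap_play adj V x \<sigma> \<tau> (Suc n) =
     (let h = trap_play adj V x \<sigma> \<tau> n in
      if trap_moves adj V h = {} then h
      else h @ [if odd (length h) then \<sigma> h else \<tau> h])"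

definition play_won_by_first ::
  "('v \<Rightarrow> 'v \<Rightarrow> bool) \<Rightarrow> 'v set \<Rightarrow> 'v \<Rightarrow> ('v list \<Rightarrow> 'v) \<Rightarrow> ('v list \<Rightarrow> 'v) \<Rightarrow> bool" where
  "play_won_by_first adj V x \<sigma> \<tau> \<longleftrightarrow>
     (\<exists>n. trap_moves adj V (trap_play adj V x \<sigma> \<tau> n) = {} \<and> even (length (trap_play adj V x \<sigma> \<tau> n)))"

definition play_won_by_second ::
  "('v \<Rightarrow> 'v \<Rightarrow> bool) \<Rightarrow> 'v set \<Rightarrow> 'v \<Rightarrow> ('v list \<Rightarrow> 'v) \<Rightarrow> ('v list \<Rightarrow> 'v) \<Rightarrow> bool" where
  "play_won_by_second adj V x \<sigma> \<tau> \<longleftrightarrow>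
     (\<exists>n. trap_moves adj V (trap_play adj V x \<sigma> \<tau> n) = {} \<and> odd (length (trap_play adj V x \<sigma> \<tau> n)))"

text \<open>By convention the game is a first-player win if the initial vertex is not in \<open>V\<close>.\<close>

definition trap_first_win :: "('v \<Rightarrow> 'v \<Rightarrow> bool) \<Rightarrow> 'v set \<Rightarrow> 'v \<Rightarrow> bool" where
  "trap_first_win adj V x \<longleftrightarrow> x \<notin> V \<or>
     (\<exists>\<sigma>. trap_strategy adj V \<sigma> \<and> (\<forall>\<tau>. trap_strategy adj V \<tau> \<longrightarrow> play_won_by_first adj V x \<sigma> \<tau>))"

definition trap_second_win :: "('v \<Rightarrow> 'v \<Rightarrow> bool) \<Rightarrow> 'v set \<Rightarrow> 'v \<Rightarrow> bool" where
  "trap_second_win adj V x \<longleftrightarrow> x \<in> V \<and>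
     (\<exists>\<tau>. trap_strategy adj V \<tau> \<and> (\<forall>\<sigma>. trap_strategy adj V \<sigma> \<longrightarrow> play_won_by_second adj V x \<sigma> \<tau>))"

definition trap_draw :: "('v \<Rightarrow> 'v \<Rightarrow> bool) \<Rightarrow> 'v set \<Rightarrow> 'v \<Rightarrow> bool" where
  "trap_draw adj V x \<longleftrightarrow> \<not> trap_first_win adj V x \<and> \<not> trap_second_win adj V x"

definition z2_adj :: "int \<times> int \<Rightarrow> int \<times> int \<Rightarrow> bool" where
  "z2_adj u v \<longleftrightarrow> \<bar>fst u - fst v\<bar> + \<bar>snd u - snd v\<bar> = 1"

definition odd_vertex :: "int \<times> int \<Rightarrow> bool" where
  "odd_vertex v \<longleftrightarrow> odd (fst v + snd v)"

text \<open>
  The law of the random configuration: a configuration \<open>\<omega>\<close> has \<open>\<omega> v = True\<close> iff \<open>v\<close> is closed.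
  Since \<open>bernoulli_pmf\<close> truncates its parameter to the unit interval, this is meaningful only for
  \<open>p\<close> and \<open>q\<close> in that interval.
\<close>

definition closed_config :: "real \<Rightarrow> real \<Rightarrow> (int \<times> int \<Rightarrow> bool) measure" where
  "closed_config p q =
     (\<Pi>\<^sub>M v\<in>UNIV. measure_pmf (bernoulli_pmf (if odd_vertex v then p else q)))"

end

theory Submission
  imports Defs "HOL-Library.Transitive_Closure_Table"
begin

text \<open>
  Call the player who moves from odd to even vertices the even player. Closed odd vertices leave
  the other player short of moves, so the even player ought to win wherever closed even vertices
  are absent. This is made rigorous on a tile of side of order \<open>ln (1 / p) / p\<close>. In rotated
  coordinates the even vertices are the points of \<open>\<int>\<^sup>2\<close> and the odd vertices are the unit squares,
  adjacent to their four corners. Consider a block of \<open>2 * n\<close> by \<open>2 * n\<close> squares, together with the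
  corners strictly inside it. There are \<open>4 * n - 1\<close> more squares than such corners. But if no inner
  corner is closed, and if each of \<open>4 * n\<close> half rows and half columns, arranged in a pinwheel,
  contains a closed square, then the open squares can be matched injectively into the inner corners
  (\<open>pinwheel_matching\<close>): along each half row or half column all squares are matched towards a closed
  square.

  Such a set of inner corners is a snare: once the opponent has moved to any square touching it,
  the even player answers with the matched corner, and the opponent's next square touches the snare
  again. The squares met are distinct, so their partners have not been visited, and the even player
  wins within the finite snare (\<open>snare_wins\<close>). Hence, if the initial vertex is surrounded by
  snares, every play either stays in a finite region or reaches a position won by the even player,
  and backward induction shows that the game is not a draw (\<open>no_draw_if_ringed_by_snares\<close>).
  This works whatever the configuration inside the surrounded region, in particular when closed even
  vertices there favour the opponent.

  Distinct tiles depend on disjoint sets of vertices and are therefore independent. With the side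
  above and \<open>q\<close> below a small multiple of \<open>(p / ln (1 / p))\<^sup>2\<close>, a tile is a snare with probability
  near 1 (\<open>scale_choice\<close>). By Peierls' counting argument the clusters of bad tiles, under king moves,
  are then almost surely finite (\<open>AE_finite_cluster\<close>), so that every vertex is surrounded by
  good tiles. When \<open>p\<close> is near 1 the hypothesis allows every \<open>q\<close>; there a tile all of whose odd
  vertices are closed is an impassable wall and serves instead of a snare.
\<close>

section \<open>Forced wins and determinacy of Trap\<close>

text \<open>
  The player \<open>b\<close> (\<open>True\<close> for the first player) can force the opponent to be stuck after fewer than
  \<open>k\<close> further moves from the position \<open>h\<close>. The explicit bound excludes infinite plays, in which a
  player would stay in winning positions for ever without winning.
\<close>

primrec wins_within ::
  "('v \<Rightarrow> 'v \<Rightarrow> bool) \<Rightarrow> 'v set \<Rightarrow> bool \<Rightarrow> nat \<Rightarrow> 'v list \<Rightarrow> bool" where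
  "wins_within adj V b 0 h = False"
| "wins_within adj V b (Suc k) h =
     (if odd (length h) = b then \<exists>v\<in>trap_moves adj V h. wins_within adj V b k (h @ [v])
      else \<forall>v\<in>trap_moves adj V h. wins_within adj V b k (h @ [v]))"

declare wins_within.simps(2) [simp del]

lemma wins_within_own:
  "odd (length h) = b \<Longrightarrow>
    wins_within adj V b (Suc k) h \<longleftrightarrow> (\<exists>v\<in>trap_moves adj V h. wins_within adj V b k (h @ [v]))"
  by (simp add: wins_within.simps(2))

lemma wins_within_other:
  "odd (length h) \<noteq> b \<Longrightarrow>
    wins_within adj V b (Suc k) h \<longleftrightarrow> (\<forall>v\<in>trap_moves adj V h. wins_within adj V b k (h @ [v]))"
  by (simp add: wins_within.simps(2))

lemma wins_within_Suc:
  "wins_within adj V b k h \<Longrightarrow> wins_within adj V b (Suc k) h"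
proof (induction k arbitrary: h)
  case (Suc k)
  show ?case
  proof (cases "odd (length h) = b")
    case True
    with Suc show ?thesis unfolding wins_within_own[OF True] by auto
  next
    case False
    with Suc show ?thesis unfolding wins_within_other[OF False] by auto
  qed
qed simp

lemma wins_within_mono:
  assumes "wins_within adj V b k h" "k \<le> l"
  shows "wins_within adj V b l h"
  using assms(2,1) by (induction rule: dec_induct) (auto intro: wins_within_Suc)

text \<open>
  One move must serve all bounds \<open>k\<close> at once, so that a single strategy decreases the bound along the
  whole play; a move that is right for the least bound does, by monotonicity. In positions of the
  opponent this is an arbitrary legal move, which makes the function a strategy.
\<close>

definition winning_move ::
  "('v \<Rightarrow> 'v \<Rightarrow> bool) \<Rightarrow> 'v set \<Rightarrow> bool \<Rightarrow> 'v list \<Rightarrow> 'v" where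
  "winning_move adj V b h = (SOME v. v \<in> trap_moves adj V h \<and>
     (odd (length h) = b \<longrightarrow>
       (\<forall>k. wins_within adj V b (Suc k) h \<longrightarrow> wins_within adj V b k (h @ [v]))))"

lemma winning_move:
  assumes "trap_moves adj V h \<noteq> {}"
  shows "winning_move adj V b h \<in> trap_moves adj V h"
    and "odd (length h) = b \<Longrightarrow> wins_within adj V b (Suc k) h \<Longrightarrow>
      wins_within adj V b k (h @ [winning_move adj V b h])"
proof -
  have "\<exists>v. v \<in> trap_moves adj V h \<and> (odd (length h) = b \<longrightarrow>
    (\<forall>k. wins_within adj V b (Suc k) h \<longrightarrow> wins_within adj V b k (h @ [v])))"
  proof (cases "odd (length h) = b \<and> (\<exists>k. wins_within adj V b (Suc k) h)")
    case True
    define l where "l = (LEAST k. wins_within adj V b (Suc k) h)"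
    have "wins_within adj V b (Suc l) h"
      unfolding l_def using True by (auto intro: LeastI)
    then obtain v where v: "v \<in> trap_moves adj V h" "wins_within adj V b l (h @ [v])"
      using True wins_within_own by metis
    moreover have "l \<le> k" if "wins_within adj V b (Suc k) h" for k
      unfolding l_def using that by (rule Least_le)
    ultimately show ?thesis by (meson wins_within_mono)
  next
    case False
    with assms show ?thesis by blast
  qed
  from someI_ex[OF this, folded winning_move_def]
  show "winning_move adj V b h \<in> trap_moves adj V h"
    and "odd (length h) = b \<Longrightarrow> wins_within adj V b (Suc k) h \<Longrightarrow>
      wins_within adj V b k (h @ [winning_move adj V b h])"
    by simp_all
qed

lemma trap_play_nonempty: "trap_play adj V x \<sigma> \<tau> n \<noteq> []"
  by (induction n) (auto simp: Let_def)

text \<open>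
  The play is kept abstract, as a sequence of positions \<open>P n\<close> with chosen moves \<open>c n\<close>, in order to
  treat a win of the first player and a win of the second player together.
\<close>

lemma play_lost_by_opponent:
  assumes step: "\<And>n. P (Suc n) = (if trap_moves adj V (P n) = {} then P n else P n @ [c n])"
    and legal: "\<And>n. trap_moves adj V (P n) \<noteq> {} \<Longrightarrow> c n \<in> trap_moves adj V (P n)"
    and best: "\<And>n. odd (length (P n)) = b \<Longrightarrow> c n = winning_move adj V b (P n)"
  shows "wins_within adj V b k (P n) \<Longrightarrow>
    \<exists>m. trap_moves adj V (P m) = {} \<and> odd (length (P m)) \<noteq> b"
proof (induction k arbitrary: n)
  case (Suc k)
  show ?case
  proof (cases "trap_moves adj V (P n) = {}")
    case True
    with Suc.prems have "odd (length (P n)) \<noteq> b" using wins_within_own by fastforce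
    with True show ?thesis by blast
  next
    case False
    then have "wins_within adj V b k (P (Suc n))"
      using Suc.prems step[of n] legal[of n] best[of n] winning_move(2)[OF False, of b k]
        wins_within_other[of "P n" b adj V k]
      by (cases "odd (length (P n)) = b") auto
    then show ?thesis by (rule Suc.IH)
  qed
qed simp

lemma wins_within_not_draw:
  assumes "wins_within adj V b k [x]"
  shows "\<not> trap_draw adj V x"
proof -
  have strat: "trap_strategy adj V (winning_move adj V b)"
    unfolding trap_strategy_def by (auto intro: winning_move(1))
  have won: "\<exists>m. trap_moves adj V (trap_play adj V x \<sigma> \<tau> m) = {} \<and>
      odd (length (trap_play adj V x \<sigma> \<tau> m)) \<noteq> b"
    if "trap_strategy adj V \<sigma>" "trap_strategy adj V \<tau>"
      "(if b then \<sigma> else \<tau>) = winning_move adj V b" for \<sigma> \<tau>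
  proof (rule play_lost_by_opponent)
    let ?P = "trap_play adj V x \<sigma> \<tau>"
    let ?c = "\<lambda>n. if odd (length (?P n)) then \<sigma> (?P n) else \<tau> (?P n)"
    show "?P (Suc n) = (if trap_moves adj V (?P n) = {} then ?P n else ?P n @ [?c n])" for n
      by (simp add: Let_def)
    show "?c n \<in> trap_moves adj V (?P n)" if "trap_moves adj V (?P n) \<noteq> {}" for n
      using that \<open>trap_strategy adj V \<sigma>\<close> \<open>trap_strategy adj V \<tau>\<close> trap_play_nonempty
      unfolding trap_strategy_def by metis
    show "?c n = winning_move adj V b (?P n)" if "odd (length (?P n)) = b" for n
      using that \<open>(if b then \<sigma> else \<tau>) = _\<close> by (auto split: if_splits)
    show "wins_within adj V b k (?P 0)" using assms by simp
  qed
  show ?thesis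
  proof (cases b)
    case True
    with won strat have "trap_first_win adj V x"
      unfolding trap_first_win_def play_won_by_first_def by auto
    then show ?thesis by (simp add: trap_draw_def)
  next
    case False
    with won strat have "x \<in> V \<Longrightarrow> trap_second_win adj V x"
      unfolding trap_second_win_def play_won_by_second_def by auto
    then show ?thesis by (auto simp: trap_draw_def trap_first_win_def)
  qed
qed

section \<open>Snares\<close>

definition open_nbrs :: "('v \<Rightarrow> 'v \<Rightarrow> bool) \<Rightarrow> 'v set \<Rightarrow> 'v set \<Rightarrow> 'v set" where
  "open_nbrs adj V R = {u \<in> V. \<exists>r\<in>R. adj r u}"

text \<open>
  The matching goes from the neighbours into \<open>R\<close>: it is the list of answers that keeps a player inside
  \<open>R\<close> while the opponent moves on the neighbours of \<open>R\<close>.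
\<close>

definition snare :: "('v \<Rightarrow> 'v \<Rightarrow> bool) \<Rightarrow> 'v set \<Rightarrow> 'v set \<Rightarrow> bool" where
  "snare adj V R \<longleftrightarrow> finite R \<and> R \<subseteq> V \<and> R \<inter> open_nbrs adj V R = {} \<and>
     (\<exists>M. inj_on M (open_nbrs adj V R) \<and> (\<forall>u\<in>open_nbrs adj V R. M u \<in> R \<and> adj u (M u)))"

text \<open>
  The player to move answers each neighbour \<open>u\<close> of \<open>R\<close> by its partner \<open>M u\<close>. From a vertex of \<open>R\<close> the
  opponent can only go to a neighbour of \<open>R\<close> again, and every answer uses up a vertex of \<open>R\<close>.
\<close>

lemma snare_wins:
  assumes "snare adj V R" "last h \<in> open_nbrs adj V R" "set h \<inter> R = {}" "h \<noteq> []" "distinct h"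
  shows "\<exists>k. wins_within adj V (odd (length h)) k h"
proof -
  let ?N = "open_nbrs adj V R"
  from assms(1) obtain M where M: "inj_on M ?N" "\<And>u. u \<in> ?N \<Longrightarrow> M u \<in> R \<and> adj u (M u)"
    and R: "finite R" "R \<subseteq> V" "R \<inter> ?N = {}"
    unfolding snare_def by blast
  have last_new: "last g \<notin> set (butlast g)" if "distinct g" "g \<noteq> []" for g :: "'a list"
    using that by (cases g rule: rev_cases) auto
  \<comment> \<open>The last assumption of this step says that visited vertices of the snare are partners of vertices visited
    before the current one; it keeps the next answer free.\<close>
  have "wins_within adj V (odd (length g)) (2 * k) g"
    if "card (R - set g) = k" "g \<noteq> []" "distinct g" "last g \<in> ?N"
      "\<And>u. u \<in> ?N \<Longrightarrow> M u \<in> set g \<Longrightarrow> u \<in> set (butlast g)" for g k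
    using that
  proof (induction k arbitrary: g)
    case 0
    then have "last g \<in> set (butlast g)" using R(1) M(2) by (auto intro: 0)
    with last_new 0 show ?case by blast
  next
    case (Suc k)
    let ?v = "M (last g)"
    have last: "last g \<notin> set (butlast g)"
      using Suc.prems(2,3) by (intro last_new)
    with Suc.prems(4,5) have new: "?v \<notin> set g" by blast
    have v: "?v \<in> R" "adj (last g) ?v" using M(2) Suc.prems(4) by auto
    have move: "?v \<in> trap_moves adj V g" using v new R by (auto simp: trap_moves_def)
    have "wins_within adj V (odd (length g)) (2 * k) (g @ [?v, w])"
      if w: "w \<in> trap_moves adj V (g @ [?v])" for w
    proof -
      have wN: "w \<in> ?N" using w v by (auto simp: trap_moves_def open_nbrs_def)
      with R have "w \<notin> R" by blast
      then have "R - set (g @ [?v, w]) = (R - set g) - {?v}" by auto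
      then have "card (R - set (g @ [?v, w])) = k"
        using Suc.prems(1) v new R by simp
      moreover have "u \<in> set (butlast (g @ [?v, w]))"
        if u: "u \<in> ?N" "M u \<in> set (g @ [?v, w])" for u
      proof -
        consider "M u \<in> set g" | "M u = ?v" | "M u = w" using u(2) by auto
        then show ?thesis
        proof cases
          case 1
          with Suc.prems(5) u(1) have "u \<in> set g" by (blast dest: in_set_butlastD)
          then show ?thesis by (simp add: butlast_append)
        next
          case 2 with M(1) u(1) Suc.prems(4) have "u = last g" by (auto dest: inj_onD)
          with Suc.prems(2) show ?thesis by (simp add: butlast_append)
        next
          case 3 with M(2) u(1) \<open>w \<notin> R\<close> show ?thesis by auto
        qed
      qed
      moreover have "distinct (g @ [?v, w])" using Suc.prems(3) new w by (auto simp: trap_moves_def)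
      ultimately have "wins_within adj V (odd (length (g @ [?v, w]))) (2 * k) (g @ [?v, w])"
        using wN by (intro Suc.IH) auto
      then show ?thesis by simp
    qed
    then have "wins_within adj V (odd (length g)) (Suc (2 * k)) (g @ [?v])"
      by (subst wins_within_other) auto
    with move have "wins_within adj V (odd (length g)) (Suc (Suc (2 * k))) g"
      by (subst wins_within_own) auto
    then show ?case by simp
  qed
  moreover have "M u \<notin> set h" if "u \<in> ?N" for u using M(2)[OF that] assms(3) by auto
  ultimately show ?thesis using assms(2,4,5) by meson
qed

lemma decided_if_moves_decided:
  assumes "finite (trap_moves adj V h)"
    and "\<And>v. v \<in> trap_moves adj V h \<Longrightarrow> \<exists>b k. wins_within adj V b k (h @ [v])"
  shows "\<exists>b k. wins_within adj V b k h"
proof (cases "\<exists>v\<in>trap_moves adj V h. \<exists>k. wins_within adj V (odd (length h)) k (h @ [v])")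
  case True
  then obtain v k where "v \<in> trap_moves adj V h" "wins_within adj V (odd (length h)) k (h @ [v])"
    by blast
  then have "wins_within adj V (odd (length h)) (Suc k) h"
    by (subst wins_within_own) auto
  then show ?thesis by blast
next
  case False
  let ?b = "\<not> odd (length h)"
  have "\<exists>k. wins_within adj V ?b k (h @ [v])" if "v \<in> trap_moves adj V h" for v
    proof -
    from assms(2)[OF that] obtain b k where "wins_within adj V b k (h @ [v])" by blast
    with False that show ?thesis by (cases "b = odd (length h)") auto
  qed
  then obtain k where k: "\<And>v. v \<in> trap_moves adj V h \<Longrightarrow> wins_within adj V ?b (k v) (h @ [v])"
    by metis
  have "wins_within adj V ?b (Max (k ` trap_moves adj V h)) (h @ [v])"
    if "v \<in> trap_moves adj V h" for v
    using k[OF that] by (rule wins_within_mono) (use assms(1) that in auto)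
  then have "wins_within adj V ?b (Suc (Max (k ` trap_moves adj V h))) h"
    by (subst wins_within_other) auto
  then show ?thesis by blast
qed

text \<open>
  Every position is won by one of the players, by backward induction on the number of unvisited
  vertices of \<open>K\<close>. A move that leaves \<open>K\<close> goes to a neighbour of some snare avoiding \<open>x\<close>; if that is
  the first visit to any neighbour of such a snare, the snare itself is still unvisited, since its
  vertices can only be entered from its neighbours, and \<open>snare_wins\<close> applies.
\<close>

theorem no_draw_if_ringed_by_snares:
  assumes sym: "\<And>u v. adj u v \<Longrightarrow> adj v u"
    and locfin: "\<And>u. finite {v. adj u v}"
    and K: "finite K" "x \<in> K"
    and leave: "\<And>u v. u \<in> K \<Longrightarrow> adj u v \<Longrightarrow> v \<in> V \<Longrightarrow>
      v \<in> K \<or> (\<exists>R. snare adj V R \<and> x \<notin> R \<and> v \<in> open_nbrs adj V R)"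
  shows "\<not> trap_draw adj V x"
proof (cases "x \<in> V")
  case False
  then show ?thesis by (simp add: trap_draw_def trap_first_win_def)
next
  case True
  define F where "F = \<Union> (open_nbrs adj V ` {R. snare adj V R \<and> x \<notin> R})"
  have decided: "\<exists>b k. wins_within adj V b k h"
    if "card (K - set h) = n" "h \<noteq> []" "distinct h" "set h \<subseteq> K \<inter> V" "set h \<inter> F = {}"
      "\<forall>y\<in>set h. y = x \<or> (\<exists>y'\<in>set h. adj y' y)" for h n
    using that
  proof (induction n arbitrary: h rule: less_induct)
    case (less n h)
    show ?case
    proof (rule decided_if_moves_decided)
      show "finite (trap_moves adj V h)"
        using locfin[of "last h"] by (rule finite_subset[rotated]) (auto simp: trap_moves_def)
      fix v assume "v \<in> trap_moves adj V h"
      then have v: "v \<in> V" "adj (last h) v" "v \<notin> set h" by (auto simp: trap_moves_def)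
      have last: "last h \<in> set h" using less.prems by simp
      show "\<exists>b k. wins_within adj V b k (h @ [v])"
      proof (cases "v \<in> F")
        case True
        then obtain R where R: "snare adj V R" "x \<notin> R" "v \<in> open_nbrs adj V R"
          unfolding F_def by blast
        have "y \<notin> R" if y: "y \<in> set h" for y
        proof
          assume "y \<in> R"
          with R less.prems(6) y obtain y' where "y' \<in> set h" "adj y' y" by auto
          with \<open>y \<in> R\<close> less.prems(4) sym have "y' \<in> open_nbrs adj V R"
            by (auto simp: open_nbrs_def)
          with R \<open>y' \<in> set h\<close> less.prems(5) show False by (auto simp: F_def)
        qed
        moreover have "v \<notin> R" using R by (auto simp: snare_def)
        ultimately show ?thesis
          using snare_wins[OF R(1), of "h @ [v]"] R(3) less.prems(3) v by auto
      next
        case False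
        with leave[of "last h" v] v last less.prems(4) have "v \<in> K" by (auto simp: F_def)
        have "K - set (h @ [v]) \<subset> K - set h" using \<open>v \<in> K\<close> v by auto
        then have "card (K - set (h @ [v])) < n"
          using K less.prems(1) by (metis finite_Diff psubset_card_mono)
        moreover have "\<forall>y\<in>set (h @ [v]). y = x \<or> (\<exists>y'\<in>set (h @ [v]). adj y' y)"
          using less.prems(6) v last by auto
        ultimately show ?thesis
          using less.prems False v \<open>v \<in> K\<close> by (intro less.IH[OF _ refl]) auto
      qed
    qed
  qed
  have "\<exists>b k. wins_within adj V b k [x]"
  proof (cases "x \<in> F")
    case True
    then obtain R where "snare adj V R" "x \<notin> R" "x \<in> open_nbrs adj V R" unfolding F_def by blast
    then show ?thesis using snare_wins[of adj V R "[x]"] by auto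
  next
    case False
    with decided[OF refl, of "[x]"] True K show ?thesis by auto
  qed
  then obtain b k where "wins_within adj V b k [x]" by blast
  then show ?thesis by (rule wins_within_not_draw)
qed

section \<open>The square lattice in rotated coordinates\<close>

definition even_site :: "int \<times> int \<Rightarrow> int \<times> int" where
  "even_site a = (fst a + snd a, fst a - snd a)"

text \<open>
  The odd vertex drawn as the unit square whose lower left corner has rotated coordinates \<open>f\<close>.
\<close>

definition odd_site :: "int \<times> int \<Rightarrow> int \<times> int" where
  "odd_site f = (fst f + snd f + 1, fst f - snd f)"

definition corner_of :: "int \<times> int \<Rightarrow> int \<times> int \<Rightarrow> bool" where
  "corner_of a f \<longleftrightarrow> fst a - fst f \<in> {0, 1} \<and> snd a - snd f \<in> {0, 1}"

lemma even_site_inject [simp]: "even_site a = even_site b \<longleftrightarrow> a = b"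
  by (auto simp: even_site_def prod_eq_iff)

lemma odd_site_inject [simp]: "odd_site f = odd_site g \<longleftrightarrow> f = g"
  by (auto simp: odd_site_def prod_eq_iff)

lemma odd_vertex_sites [simp]: "odd_vertex (odd_site f)" "\<not> odd_vertex (even_site a)"
  by (auto simp: odd_vertex_def odd_site_def even_site_def)

lemma even_site_neq_odd_site [simp]: "even_site a \<noteq> odd_site f" "odd_site f \<noteq> even_site a"
  by (metis odd_vertex_sites)+

lemma site_cases:
  obtains a where "v = even_site a" | f where "v = odd_site f"
proof (cases "odd_vertex v")
  case True
  then have "v = odd_site ((fst v + snd v - 1) div 2, (fst v - snd v - 1) div 2)"
    unfolding odd_vertex_def odd_site_def prod_eq_iff fst_conv snd_conv by presburger
  then show ?thesis using that by blast
next
  case False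
  then have "v = even_site ((fst v + snd v) div 2, (fst v - snd v) div 2)"
    unfolding odd_vertex_def even_site_def prod_eq_iff fst_conv snd_conv by presburger
  then show ?thesis using that by blast
qed

lemma z2_adj_sym: "z2_adj u v \<Longrightarrow> z2_adj v u"
  by (simp add: z2_adj_def abs_minus_commute)

lemma finite_z2_nbrs: "finite {v. z2_adj u v}"
proof (rule finite_subset)
  show "{v. z2_adj u v} \<subseteq> {fst u - 1..fst u + 1} \<times> {snd u - 1..snd u + 1}"
    by (auto simp: z2_adj_def)
qed simp

lemma z2_adj_even_odd [simp]: "z2_adj (even_site a) (odd_site f) \<longleftrightarrow> corner_of a f"
  unfolding z2_adj_def even_site_def odd_site_def corner_of_def fst_conv snd_conv
    insert_iff empty_iff by presburger

lemma z2_adj_odd_even [simp]: "z2_adj (odd_site f) (even_site a) \<longleftrightarrow> corner_of a f"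
  using z2_adj_sym z2_adj_even_odd by blast

lemma z2_adj_parity: "z2_adj u v \<Longrightarrow> odd_vertex u \<longleftrightarrow> \<not> odd_vertex v"
  unfolding z2_adj_def odd_vertex_def by presburger

lemma not_z2_adj_same [simp]:
  "\<not> z2_adj (even_site a) (even_site b)" "\<not> z2_adj (odd_site f) (odd_site g)"
  using z2_adj_parity odd_vertex_sites by blast+

section \<open>The pinwheel matching\<close>

definition half :: "int \<Rightarrow> bool \<Rightarrow> int set" where
  "half n up = (if up then {n..<2 * n} else {0..<n})"

text \<open>
  The block of \<open>2 * n\<close> by \<open>2 * n\<close> squares is cut into four quadrants. In the upper right and the lower
  left one, squares are moved along their row towards the closed square \<open>r b\<close> of that row; in the
  other two, along their column towards \<open>c a\<close>. Each line uses the corners on its side nearer to the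
  centre of the block.
\<close>

definition pinwheel :: "int \<Rightarrow> (int \<Rightarrow> int) \<Rightarrow> (int \<Rightarrow> int) \<Rightarrow> int \<times> int \<Rightarrow> int \<times> int" where
  "pinwheel n r c = (\<lambda>(a, b).
     if n \<le> a \<longleftrightarrow> n \<le> b
     then (if a < r b then a + 1 else a, if n \<le> b then b else b + 1)
     else (if n \<le> a then a else a + 1, if b < c a then b + 1 else b))"

text \<open>
  Within one line, the squares on both sides of the closed one are pushed towards it; since that
  square needs no corner, the two streams do not collide and no stream leaves the block. The sides
  chosen in the four quadrants make their sets of corners disjoint: they turn around the centre
  \<open>(n, n)\<close>, the only inner corner outside all four.
\<close>

lemma pinwheel_matching:
  assumes n: "0 < n"
    and r: "\<And>k. k \<in> {0..<2 * n} \<Longrightarrow> r k \<in> half n (n \<le> k)"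
    and c: "\<And>k. k \<in> {0..<2 * n} \<Longrightarrow> c k \<in> half n (k < n)"
    and Q: "Q \<subseteq> {0..<2 * n} \<times> {0..<2 * n}"
    and avoid: "\<And>k. (r k, k) \<notin> Q" "\<And>k. (k, c k) \<notin> Q"
  shows "inj_on (pinwheel n r c) Q"
    and "d \<in> Q \<Longrightarrow> pinwheel n r c d \<in> {1..<2 * n} \<times> {1..<2 * n}"
    and "corner_of (pinwheel n r c d) d"
proof -
  have target: "
     (if n \<le> a \<longleftrightarrow> n \<le> b then a \<noteq> r b else b \<noteq> c a) \<and>
     r b \<in> half n (n \<le> b) \<and> c a \<in> half n (a < n) \<and> 0 \<le> a \<and> 0 \<le> b \<and> a < 2 * n \<and> b < 2 * n"
    if "(a, b) \<in> Q" for a b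
    using that Q avoid r[of b] c[of a] by fastforce
  show "inj_on (pinwheel n r c) Q"
  proof (rule inj_onI, clarify)
    fix a b a' b'
    assume d: "(a, b) \<in> Q" "(a', b') \<in> Q" "pinwheel n r c (a, b) = pinwheel n r c (a', b')"
    show "a = a' \<and> b = b'"
      using target[OF d(1)] target[OF d(2)] d(3)
      by (cases "n \<le> a"; cases "n \<le> b"; cases "n \<le> a'"; cases "n \<le> b'")
         (auto simp: pinwheel_def half_def split: if_splits)
  qed
  show "pinwheel n r c d \<in> {1..<2 * n} \<times> {1..<2 * n}" if "d \<in> Q"
  proof -
    obtain a b where d: "d = (a, b)" by fastforce
    show ?thesis
      using target[of a b] that unfolding d
      by (auto simp: pinwheel_def half_def split: if_splits)
  qed
  show "corner_of (pinwheel n r c d) d"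
    by (auto simp: pinwheel_def corner_of_def split: prod.splits)
qed

section \<open>Tiles\<close>

definition in_tile :: "int \<Rightarrow> int \<times> int \<Rightarrow> int \<times> int \<Rightarrow> int \<times> int" where
  "in_tile n z d = (2 * n * fst z + fst d, 2 * n * snd z + snd d)"

definition tile_of :: "int \<Rightarrow> int \<times> int \<Rightarrow> int \<times> int" where
  "tile_of n f = (fst f div (2 * n), snd f div (2 * n))"

lemma in_tile_inject [simp]: "in_tile n z d = in_tile n z e \<longleftrightarrow> d = e"
  by (auto simp: in_tile_def prod_eq_iff)

lemma tile_of_in_tile:
  assumes "d \<in> {0..<2 * n} \<times> {0..<2 * n}"
  shows "tile_of n (in_tile n z d) = z"
  using assms by (cases d; cases z) (auto simp: tile_of_def in_tile_def)

lemma tile_offset: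
  assumes "0 < n"
  obtains d where "f = in_tile n (tile_of n f) d" "d \<in> {0..<2 * n} \<times> {0..<2 * n}"
proof
  show "f = in_tile n (tile_of n f) (fst f mod (2 * n), snd f mod (2 * n))"
    by (simp add: in_tile_def tile_of_def prod_eq_iff)
  show "(fst f mod (2 * n), snd f mod (2 * n)) \<in> {0..<2 * n} \<times> {0..<2 * n}"
    using assms by simp
qed

lemma corner_of_in_tile [simp]:
  "corner_of (in_tile n z d) (in_tile n z e) \<longleftrightarrow> corner_of d e"
  by (simp add: corner_of_def in_tile_def)

text \<open>
  The two ways for a tile to stop the token: all its squares are closed, or the corners in its
  interior form a snare.
\<close>

definition wall_tile :: "int \<Rightarrow> (int \<times> int \<Rightarrow> bool) \<Rightarrow> int \<times> int \<Rightarrow> bool" where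
  "wall_tile n \<omega> z \<longleftrightarrow> (\<forall>d\<in>{0..<2 * n} \<times> {0..<2 * n}. \<omega> (odd_site (in_tile n z d)))"

definition snare_tile :: "int \<Rightarrow> (int \<times> int \<Rightarrow> bool) \<Rightarrow> int \<times> int \<Rightarrow> bool" where
  "snare_tile n \<omega> z \<longleftrightarrow>
     (\<forall>d\<in>{1..<2 * n} \<times> {1..<2 * n}. \<not> \<omega> (even_site (in_tile n z d))) \<and>
     (\<forall>k\<in>{0..<2 * n}. \<exists>a\<in>half n (n \<le> k). \<omega> (odd_site (in_tile n z (a, k)))) \<and>
     (\<forall>k\<in>{0..<2 * n}. \<exists>b\<in>half n (k < n). \<omega> (odd_site (in_tile n z (k, b))))"

definition tile_interior :: "int \<Rightarrow> int \<times> int \<Rightarrow> (int \<times> int) set" where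
  "tile_interior n z = even_site ` in_tile n z ` ({1..<2 * n} \<times> {1..<2 * n})"

text \<open>
  Every square of the tile has a corner in the interior, and no other square does. Thus the
  snare of a good tile guards the whole tile, and the tiles leave no square of the lattice out.
\<close>

lemma open_nbrs_tile_interior:
  assumes "0 < n"
  shows "open_nbrs z2_adj V (tile_interior n z) =
    odd_site ` in_tile n z ` {d \<in> {0..<2 * n} \<times> {0..<2 * n}. odd_site (in_tile n z d) \<in> V}"
    (is "?L = ?R")
proof
  show "?L \<subseteq> ?R"
  proof
    fix u assume "u \<in> ?L"
    then obtain d where d: "d \<in> {1..<2 * n} \<times> {1..<2 * n}" "z2_adj (even_site (in_tile n z d)) u"
      and u: "u \<in> V"
      by (auto simp: open_nbrs_def tile_interior_def)
    obtain f where f: "u = odd_site f" "corner_of (in_tile n z d) f"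
      using d(2) by (cases u rule: site_cases) auto
    define e where "e = (fst f - 2 * n * fst z, snd f - 2 * n * snd z)"
    have fe: "f = in_tile n z e" by (simp add: in_tile_def e_def)
    moreover have "e \<in> {0..<2 * n} \<times> {0..<2 * n}"
      using d(1) f(2) unfolding e_def by (auto simp: in_tile_def corner_of_def)
    ultimately show "u \<in> ?R" using u unfolding f(1) fe by blast
  qed
  show "?R \<subseteq> ?L"
  proof
    fix u assume "u \<in> ?R"
    then obtain a b where ab: "a \<in> {0..<2 * n}" "b \<in> {0..<2 * n}" "u \<in> V"
      and u: "u = odd_site (in_tile n z (a, b))"
      by auto
    define d where "d = (if a = 0 then 1 else a, if b = 0 then 1 else b)"
    have "d \<in> {1..<2 * n} \<times> {1..<2 * n}" "corner_of d (a, b)"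
      using ab assms by (auto simp: corner_of_def d_def)
    then have "even_site (in_tile n z d) \<in> tile_interior n z"
      "z2_adj (even_site (in_tile n z d)) (odd_site (in_tile n z (a, b)))"
      by (auto simp: tile_interior_def)
    with ab(3) show "u \<in> ?L" unfolding open_nbrs_def u by blast
  qed
qed

lemma snare_tile_interior:
  assumes n: "0 < n" and good: "snare_tile n \<omega> z"
  shows "snare z2_adj {v. \<not> \<omega> v} (tile_interior n z)"
proof -
  let ?V = "{v. \<not> \<omega> v}"
  let ?B = "{0..<2 * n} \<times> {0..<2 * n}"
  define Q where "Q = {d \<in> ?B. odd_site (in_tile n z d) \<in> ?V}"
  from good obtain r where r: "\<And>k. k \<in> {0..<2 * n} \<Longrightarrow>
      r k \<in> half n (n \<le> k) \<and> \<omega> (odd_site (in_tile n z (r k, k)))"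
    unfolding snare_tile_def by metis
  from good obtain c where c: "\<And>k. k \<in> {0..<2 * n} \<Longrightarrow>
      c k \<in> half n (k < n) \<and> \<omega> (odd_site (in_tile n z (k, c k)))"
    unfolding snare_tile_def by metis
  have Q: "Q \<subseteq> ?B" "\<And>k. (r k, k) \<notin> Q" "\<And>k. (k, c k) \<notin> Q"
    using r c by (auto simp: Q_def)
  note match = pinwheel_matching[OF n, of r c, OF _ _ Q]
  have N: "open_nbrs z2_adj ?V (tile_interior n z) = odd_site ` in_tile n z ` Q"
    unfolding Q_def by (rule open_nbrs_tile_interior[OF n])
  have inj: "inj (odd_site \<circ> in_tile n z)" by (simp add: inj_on_def)
  define M where "M = even_site \<circ> in_tile n z \<circ> pinwheel n r c \<circ> inv (odd_site \<circ> in_tile n z)"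
  have M: "M (odd_site (in_tile n z d)) = even_site (in_tile n z (pinwheel n r c d))" for d
    unfolding M_def using inv_f_f[OF inj, of d] by simp
  have "inj_on M (odd_site ` in_tile n z ` Q)"
    using match(1) r c by (auto simp: inj_on_def M)
  moreover have "\<forall>u\<in>odd_site ` in_tile n z ` Q. M u \<in> tile_interior n z \<and> z2_adj u (M u)"
    using match(2,3) r c by (auto simp: M tile_interior_def)
  moreover have "finite (tile_interior n z)" by (simp add: tile_interior_def)
  moreover have "tile_interior n z \<subseteq> ?V"
    using good by (auto simp: tile_interior_def snare_tile_def)
  moreover have "tile_interior n z \<inter> odd_site ` in_tile n z ` Q = {}"
    by (auto simp: tile_interior_def)
  ultimately show ?thesis unfolding snare_def N by blast
qed

definition bad_tile :: "int \<Rightarrow> (int \<times> int \<Rightarrow> bool) \<Rightarrow> int \<times> int \<Rightarrow> bool" where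
  "bad_tile n \<omega> z \<longleftrightarrow> \<not> wall_tile n \<omega> z \<and> \<not> snare_tile n \<omega> z"

definition king_nbrs :: "int \<times> int \<Rightarrow> (int \<times> int) set" where
  "king_nbrs z = {fst z - 1..fst z + 1} \<times> {snd z - 1..snd z + 1}"

definition bad_step :: "int \<Rightarrow> (int \<times> int \<Rightarrow> bool) \<Rightarrow> int \<times> int \<Rightarrow> int \<times> int \<Rightarrow> bool" where
  "bad_step n \<omega> y z \<longleftrightarrow> z \<in> king_nbrs y \<and> bad_tile n \<omega> z"

lemma div_near:
  fixes a b m :: int
  assumes "\<bar>a - b\<bar> \<le> 1" "0 < m"
  shows "a div m - b div m \<in> {-1..1}"
proof -
  have "a div m \<le> (b + m) div m" "b div m \<le> (a + m) div m"
    using assms by (intro zdiv_mono1; linarith)+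
  with assms(2) show ?thesis by simp
qed

text \<open>
  Two moves of a play change the square to one with a common corner, so the tile makes at most a
  king move.
\<close>

lemma tile_of_common_corner:
  assumes "0 < n" "corner_of a f" "corner_of a g"
  shows "tile_of n g \<in> king_nbrs (tile_of n f)"
proof -
  have "\<bar>fst g - fst f\<bar> \<le> 1" "\<bar>snd g - snd f\<bar> \<le> 1" using assms by (auto simp: corner_of_def)
  from div_near[OF this(1), of "2 * n"] div_near[OF this(2), of "2 * n"] assms(1)
  show ?thesis by (auto simp: king_nbrs_def tile_of_def)
qed

text \<open>
  The finite region consists of the squares in the tiles that can be reached by bad tiles from the
  tile of \<open>x\<close>, with all their corners. The tile of \<open>x\<close> belongs to the region even if it is good,
  because its snare may contain \<open>x\<close> and is then already damaged at the start; all other snares avoid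
  \<open>x\<close>.
\<close>

theorem no_draw_if_bad_clusters_finite:
  assumes n: "0 < n" and fin: "\<And>z. finite {y. (bad_step n \<omega>)\<^sup>*\<^sup>* z y}"
  shows "\<not> trap_draw z2_adj {v. \<not> \<omega> v} x"
proof -
  let ?V = "{v. \<not> \<omega> v}"
  obtain s where s: "x = even_site s \<or> x = odd_site s" by (cases x rule: site_cases) auto
  define C where "C = {y. (bad_step n \<omega>)\<^sup>*\<^sup>* (tile_of n s) y}"
  define A where "A = {f. tile_of n f \<in> C}"
  define K where "K = odd_site ` A \<union> {v. \<exists>f\<in>A. z2_adj (odd_site f) v}"
  have sC: "tile_of n s \<in> C" by (simp add: C_def)
  have "A \<subseteq> (\<Union>z\<in>C. in_tile n z ` ({0..<2 * n} \<times> {0..<2 * n}))"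
  proof
    fix f assume "f \<in> A"
    with tile_offset[OF n, of f] show "f \<in> (\<Union>z\<in>C. in_tile n z ` ({0..<2 * n} \<times> {0..<2 * n}))"
      unfolding A_def by blast
  qed
  then have "finite A" by (rule finite_subset) (use fin C_def in auto)
  moreover have "{v. \<exists>f\<in>A. z2_adj (odd_site f) v} = (\<Union>f\<in>A. {v. z2_adj (odd_site f) v})" by auto
  ultimately have finK: "finite K" unfolding K_def using finite_z2_nbrs by auto
  have xK: "x \<in> K"
  proof -
    have "s \<in> A" using sC by (simp add: A_def)
    moreover have "corner_of s s" by (simp add: corner_of_def)
    ultimately show ?thesis using s unfolding K_def by auto
  qed
  show ?thesis
  proof (rule no_draw_if_ringed_by_snares[OF z2_adj_sym finite_z2_nbrs finK xK])
    fix u v assume u: "u \<in> K" and uv: "z2_adj u v" and v: "v \<in> ?V"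
    show "v \<in> K \<or> (\<exists>R. snare z2_adj ?V R \<and> x \<notin> R \<and> v \<in> open_nbrs z2_adj ?V R)"
    proof (cases u rule: site_cases)
      case (2 f)
      with u uv show ?thesis by (auto simp: K_def)
    next
      case (1 a)
      then obtain f where f: "f \<in> A" "corner_of a f" using u by (auto simp: K_def)
      obtain g where g: "v = odd_site g" "corner_of a g"
        using uv 1 by (cases v rule: site_cases) auto
      let ?z = "tile_of n g"
      show ?thesis
      proof (cases "?z \<in> C")
        case True
        with g(1) show ?thesis by (auto simp: K_def A_def)
      next
        case False
        have "\<not> bad_tile n \<omega> ?z"
        proof
          assume "bad_tile n \<omega> ?z"
          with tile_of_common_corner[OF n f(2) g(2)] have "bad_step n \<omega> (tile_of n f) ?z"
            by (simp add: bad_step_def)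
          with f(1) False show False by (auto simp: A_def C_def intro: rtranclp.intros)
        qed
        moreover obtain d where d: "g = in_tile n ?z d" "d \<in> {0..<2 * n} \<times> {0..<2 * n}"
          using tile_offset[OF n] by blast
        then have vd: "v = odd_site (in_tile n ?z d)" using g(1) by simp
        with v d(2) have "\<not> wall_tile n \<omega> ?z" unfolding wall_tile_def by blast
        ultimately have sn: "snare_tile n \<omega> ?z" by (simp add: bad_tile_def)
        have "v \<in> open_nbrs z2_adj ?V (tile_interior n ?z)"
          unfolding open_nbrs_tile_interior[OF n] using d(2) v vd by blast
        moreover have "x \<notin> tile_interior n ?z"
        proof
          assume "x \<in> tile_interior n ?z"
          then obtain e where "x = even_site (in_tile n ?z e)" "e \<in> {1..<2 * n} \<times> {1..<2 * n}"
            by (auto simp: tile_interior_def)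
          with s have "s = in_tile n ?z e" "e \<in> {0..<2 * n} \<times> {0..<2 * n}" by auto
          with tile_of_in_tile sC False show False by metis
        qed
        ultimately show ?thesis using snare_tile_interior[OF n sn] by blast
      qed
    qed
  qed
qed

section \<open>Independence in product measures\<close>

text \<open>
  Finitely many coordinates with finitely many values give a finite discrete space. Hence events
  determined by finitely many coordinates never need a separate measurability proof.
\<close>

lemma sets_PiM_finite_pmf:
  fixes D :: "'i \<Rightarrow> 'c::finite pmf"
  assumes "finite K" "S \<subseteq> space (Pi\<^sub>M K (\<lambda>v. measure_pmf (D v)))"
  shows "S \<in> sets (Pi\<^sub>M K (\<lambda>v. measure_pmf (D v)))"
proof -
  have space: "space (Pi\<^sub>M K (\<lambda>v. measure_pmf (D v))) = K \<rightarrow>\<^sub>E UNIV" by (simp add: space_PiM)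
  then have "y \<in> S \<Longrightarrow> (\<Pi>\<^sub>E v\<in>K. {y v}) = {y}" for y
    using assms(2) by (intro PiE_singleton) (auto simp: PiE_def)
  then have "S = (\<Union>y\<in>S. \<Pi>\<^sub>E v\<in>K. {y v})" by simp
  moreover have "finite S"
    using assms(2) unfolding space by (rule finite_subset) (simp add: assms(1) finite_PiE)
  then have "(\<Union>y\<in>S. \<Pi>\<^sub>E v\<in>K. {y v}) \<in> sets (Pi\<^sub>M K (\<lambda>v. measure_pmf (D v)))"
    by (intro sets.finite_UN sets_PiM_I_finite assms(1)) auto
  ultimately show ?thesis by simp
qed

context
  fixes D :: "'i \<Rightarrow> 'c::finite pmf"
begin

interpretation product_prob_space "\<lambda>v. measure_pmf (D v)" UNIV
  by (intro product_prob_spaceI measure_pmf.prob_space_axioms)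

lemma space_PiM_pmf: "space (\<Pi>\<^sub>M v\<in>UNIV. measure_pmf (D v)) = UNIV"
  by (simp add: space_PiM)

lemma prob_cylinder:
  assumes "finite J"
  shows "measure (\<Pi>\<^sub>M v\<in>UNIV. measure_pmf (D v)) {\<omega>. \<forall>v\<in>J. \<omega> v = b v} = (\<Prod>v\<in>J. pmf (D v) (b v))"
proof -
  have "{\<omega>. \<forall>v\<in>J. \<omega> v = b v} =
      prod_emb UNIV (\<lambda>v. measure_pmf (D v)) J (\<Pi>\<^sub>E v\<in>J. {b v})"
    by (auto simp: prod_emb_def space_PiM PiE_iff)
  then show ?thesis
    using measure_PiM_emb[of J "\<lambda>v. {b v}"] assms by (simp add: measure_pmf_single)
qed

lemma indep_coordinates:
  "P.indep_vars (\<lambda>v. measure_pmf (D v)) (\<lambda>v \<omega>. \<omega> v) UNIV"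
  by (subst P.indep_vars_iff_distr_eq_PiM) (auto simp: distr_id2 restrict_UNIV PiM_component)

lemma determined_event_measurable:
  assumes "finite K" "\<And>\<omega>. E \<omega> \<longleftrightarrow> E (restrict \<omega> K)"
  shows "{\<omega>. E \<omega>} \<in> sets (\<Pi>\<^sub>M v\<in>UNIV. measure_pmf (D v))"
proof -
  let ?P = "\<Pi>\<^sub>M v\<in>UNIV. measure_pmf (D v)"
  let ?PK = "\<Pi>\<^sub>M v\<in>K. measure_pmf (D v)"
  have "(\<lambda>\<omega>. restrict \<omega> K) -` {y \<in> space ?PK. E y} \<inter> space ?P \<in> sets ?P"
    by (rule measurable_sets[OF measurable_restrict_subset])
       (auto intro: sets_PiM_finite_pmf[OF assms(1)])
  moreover have "(\<lambda>\<omega>. restrict \<omega> K) -` {y \<in> space ?PK. E y} \<inter> space ?P = {\<omega>. E \<omega>}"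
    using assms(2) by (auto simp: space_PiM)
  ultimately show ?thesis by simp
qed

lemma prob_disjointly_determined_events:
  assumes Z: "finite Z" and K: "\<And>z. finite (K z)" "disjoint_family_on K Z"
    and E: "\<And>z \<omega>. E z \<omega> \<longleftrightarrow> E z (restrict \<omega> (K z))"
  shows "measure (\<Pi>\<^sub>M v\<in>UNIV. measure_pmf (D v)) {\<omega>. \<forall>z\<in>Z. E z \<omega>} =
    (\<Prod>z\<in>Z. measure (\<Pi>\<^sub>M v\<in>UNIV. measure_pmf (D v)) {\<omega>. E z \<omega>})"
proof (cases "Z = {}")
  case True
  then show ?thesis using P.prob_space by (simp add: space_PiM_pmf)
next
  case False
  let ?P = "\<Pi>\<^sub>M v\<in>UNIV. measure_pmf (D v)"
  let ?PK = "\<lambda>z. \<Pi>\<^sub>M v\<in>K z. measure_pmf (D v)"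
  let ?A = "\<lambda>z. {y \<in> space (?PK z). E z y}"
  have "P.indep_vars ?PK (\<lambda>z \<omega>. restrict (\<lambda>v. \<omega> v) (K z)) Z"
    by (rule P.indep_vars_restrict[OF indep_coordinates _ K(2)]) simp
  moreover have A: "?A z \<in> sets (?PK z)" for z
    by (rule sets_PiM_finite_pmf[OF K(1)]) auto
  ultimately have "P.prob (\<Inter>z\<in>Z. (\<lambda>\<omega>. restrict \<omega> (K z)) -` ?A z \<inter> space ?P) =
      (\<Prod>z\<in>Z. P.prob ((\<lambda>\<omega>. restrict \<omega> (K z)) -` ?A z \<inter> space ?P))"
    using False Z by (intro P.indep_varsD[OF _ _ _ order_refl]) auto
  moreover have "(\<lambda>\<omega>. restrict \<omega> (K z)) -` ?A z \<inter> space ?P = {\<omega>. E z \<omega>}" for z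
    using E[of z] by (auto simp: space_PiM)
  moreover have "(\<Inter>z\<in>Z. {\<omega>. E z \<omega>}) = {\<omega>. \<forall>z\<in>Z. E z \<omega>}" by auto
  ultimately show ?thesis by (simp only:)
qed

end

section \<open>Finite clusters by Peierls' argument\<close>

lemma finite_king_nbrs: "finite (king_nbrs z)"
  by (simp add: king_nbrs_def)

lemma card_king_nbrs: "card (king_nbrs z) = 9"
  by (simp add: king_nbrs_def card_cartesian_product)

text \<open>
  The starting point is left out of the list, because the first tile of a cluster may be good.
\<close>

primrec king_walks :: "nat \<Rightarrow> int \<times> int \<Rightarrow> (int \<times> int) list set" where
  "king_walks 0 z = {[]}"
| "king_walks (Suc m) z = (\<Union>y\<in>king_nbrs z. (#) y ` king_walks m y)"

lemma finite_king_walks: "finite (king_walks m z)"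
  by (induction m arbitrary: z) (auto simp: finite_king_nbrs)

lemma length_king_walks: "xs \<in> king_walks m z \<Longrightarrow> length xs = m"
  by (induction m arbitrary: z xs) auto

lemma card_king_walks: "card (king_walks m z) \<le> 9 ^ m"
proof (induction m arbitrary: z)
  case (Suc m)
  have "card (king_walks (Suc m) z) \<le> (\<Sum>y\<in>king_nbrs z. card ((#) y ` king_walks m y))"
    unfolding king_walks.simps by (rule card_UN_le[OF finite_king_nbrs])
  also have "\<dots> \<le> (\<Sum>y\<in>king_nbrs z. 9 ^ m)"
    by (intro sum_mono order_trans[OF card_image_le Suc] finite_king_walks)
  also have "\<dots> = 9 ^ Suc m" by (simp add: card_king_nbrs)
  finally show ?case .
qed simp

lemma path_is_king_walk:
  assumes "rtrancl_path (\<lambda>y z. z \<in> king_nbrs y \<and> B z) z xs y"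
  shows "m \<le> length xs \<Longrightarrow> take m xs \<in> king_walks m z"
    and "\<forall>w\<in>set xs. B w" and "last (z # xs) = y"
proof -
  show "m \<le> length xs \<Longrightarrow> take m xs \<in> king_walks m z"
    using assms
  proof (induction arbitrary: m)
    case (step x y ys z)
    then show ?case by (cases m) auto
  qed simp
qed (use assms in \<open>induction; auto\<close>)+

text \<open>
  A path can be made self-avoiding, and so can each of its initial segments. If no self-avoiding walk
  of length \<open>m\<close> is entirely bad, the cluster is therefore reached by walks shorter than \<open>m\<close>.
\<close>

lemma finite_cluster:
  assumes "\<And>xs. xs \<in> king_walks m z \<Longrightarrow> distinct xs \<Longrightarrow> \<exists>w\<in>set xs. \<not> B w"
  shows "finite {y. (\<lambda>y z. z \<in> king_nbrs y \<and> B z)\<^sup>*\<^sup>* z y}"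
proof (rule finite_subset)
  show "{y. (\<lambda>y z. z \<in> king_nbrs y \<and> B z)\<^sup>*\<^sup>* z y} \<subseteq>
    (\<Union>k<m. (\<lambda>xs. last (z # xs)) ` king_walks k z)"
  proof
    fix y assume "y \<in> {y. (\<lambda>y z. z \<in> king_nbrs y \<and> B z)\<^sup>*\<^sup>* z y}"
    then obtain xs where xs: "rtrancl_path (\<lambda>y z. z \<in> king_nbrs y \<and> B z) z xs y"
      unfolding rtranclp_eq_rtrancl_path by blast
    then obtain ys where ys: "rtrancl_path (\<lambda>y z. z \<in> king_nbrs y \<and> B z) z ys y"
      "distinct (z # ys)"
      by (rule rtrancl_path_distinct)
    note walk = path_is_king_walk[OF ys(1)]
    have "length ys < m"
    proof (rule ccontr)
      assume "\<not> length ys < m"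
      then have "take m ys \<in> king_walks m z" by (intro walk(1)) simp
      moreover have "distinct (take m ys)" using ys(2) by simp
      ultimately obtain w where "w \<in> set (take m ys)" "\<not> B w" using assms by blast
      with walk(2) show False by (auto dest: in_set_takeD)
    qed
    moreover have "ys \<in> king_walks (length ys) z" using walk(1)[of "length ys"] by simp
    ultimately show "y \<in> (\<Union>k<m. (\<lambda>xs. last (z # xs)) ` king_walks k z)"
      using walk(3) by blast
  qed
qed (simp add: finite_king_walks)

text \<open>
  There are at most \<open>9 ^ m\<close> king walks of length \<open>m\<close>, and a self-avoiding one is entirely bad with
  probability at most \<open>(1/16) ^ m\<close>; the product tends to 0.
\<close>

lemma (in prob_space) AE_finite_cluster:
  assumes meas: "\<And>z. {\<omega> \<in> space M. B z \<omega>} \<in> events"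
    and rare: "\<And>Z. finite Z \<Longrightarrow> prob {\<omega> \<in> space M. \<forall>z\<in>Z. B z \<omega>} \<le> (1/16) ^ card Z"
  shows "AE \<omega> in M. finite {y. (\<lambda>y z. z \<in> king_nbrs y \<and> B z \<omega>)\<^sup>*\<^sup>* z y}"
proof -
  define E where "E xs = {\<omega> \<in> space M. \<forall>w\<in>set xs. B w \<omega>}" for xs
  define W where "W m = {xs \<in> king_walks m z. distinct xs}" for m
  define A where "A m = (\<Union>xs\<in>W m. E xs)" for m
  have finW: "finite (W m)" for m by (simp add: W_def finite_king_walks)
  have E[measurable]: "E xs \<in> events" for xs
    unfolding E_def by (intro sets.sets_Collect_finite_All' sets.sets_Collect_finite_All meas) auto
  have A[measurable]: "A m \<in> events" for m
    unfolding A_def using finW by (intro sets.finite_UN E)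
  have PA: "prob (A m) \<le> (9/16) ^ m" for m
  proof -
    have "prob (A m) \<le> (\<Sum>xs\<in>W m. prob (E xs))"
      unfolding A_def by (rule finite_measure_subadditive_finite[OF finW]) (use E in auto)
    also have "\<dots> \<le> (\<Sum>xs\<in>W m. (1/16) ^ m)"
    proof (rule sum_mono)
      fix xs assume "xs \<in> W m"
      then have "card (set xs) = m" by (auto simp: W_def distinct_card length_king_walks)
      with rare[of "set xs"] show "prob (E xs) \<le> (1/16) ^ m" by (simp add: E_def)
    qed
    also have "\<dots> = real (card (W m)) * (1/16) ^ m" by simp
    also have "\<dots> \<le> 9 ^ m * (1/16) ^ m"
    proof -
      have "card (W m) \<le> card (king_walks m z)"
        by (rule card_mono[OF finite_king_walks]) (auto simp: W_def)
      then have "card (W m) \<le> 9 ^ m" using card_king_walks[of m z] by simp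
      then have "real (card (W m)) \<le> 9 ^ m" by (metis of_nat_le_iff of_nat_numeral of_nat_power)
      then show ?thesis by (intro mult_right_mono) auto
    qed
    also have "\<dots> = (9/16) ^ m" by (simp add: power_divide)
    finally show ?thesis .
  qed
  have "prob (\<Inter>m. A m) \<le> (9/16) ^ m" for m
    by (rule order_trans[OF finite_measure_mono PA[of m]]) (use A in auto)
  moreover have "(\<lambda>m. (9/16::real) ^ m) \<longlonglongrightarrow> 0" by (rule LIMSEQ_realpow_zero) auto
  ultimately have "prob (\<Inter>m. A m) \<le> 0" by (intro LIMSEQ_le_const) auto
  then have "prob (\<Inter>m. A m) = 0" by (simp add: measure_le_0_iff)
  then have "AE \<omega> in M. \<omega> \<notin> (\<Inter>m. A m)"
    by (subst (asm) prob_eq_0) auto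
  then show ?thesis
  proof (rule AE_mp, intro AE_I2 impI)
    fix \<omega> assume \<omega>: "\<omega> \<in> space M" "\<omega> \<notin> (\<Inter>m. A m)"
    then obtain m where "\<omega> \<notin> A m" by blast
    with \<omega>(1) show "finite {y. (\<lambda>y z. z \<in> king_nbrs y \<and> B z \<omega>)\<^sup>*\<^sup>* z y}"
      by (intro finite_cluster[of m]) (auto simp: A_def E_def W_def)
  qed
qed

section \<open>Good tiles in the random configuration\<close>

definition tile_sites :: "int \<Rightarrow> int \<times> int \<Rightarrow> (int \<times> int) set" where
  "tile_sites n z = odd_site ` in_tile n z ` ({0..<2 * n} \<times> {0..<2 * n}) \<union> tile_interior n z"

lemma half_subset: "0 < n \<Longrightarrow> half n up \<subseteq> {0..<2 * n}"
  by (auto simp: half_def)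

lemma finite_tile_sites: "finite (tile_sites n z)"
  by (simp add: tile_sites_def tile_interior_def)

lemma disjoint_tile_sites: "disjoint_family_on (tile_sites n) Z"
proof -
  have "y = z" if "v \<in> tile_sites n y" "v \<in> tile_sites n z" for v y z
  proof -
    have "\<exists>d\<in>{0..<2 * n} \<times> {0..<2 * n}. v = odd_site (in_tile n w d) \<or> v = even_site (in_tile n w d)"
      if "v \<in> tile_sites n w" for w
      using that unfolding tile_sites_def tile_interior_def by force
    with that obtain d e where
      "v = odd_site (in_tile n y d) \<or> v = even_site (in_tile n y d)"
      "v = odd_site (in_tile n z e) \<or> v = even_site (in_tile n z e)"
      and de: "d \<in> {0..<2 * n} \<times> {0..<2 * n}" "e \<in> {0..<2 * n} \<times> {0..<2 * n}"
      by meson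
    then have "in_tile n y d = in_tile n z e" by auto
    with de show ?thesis using tile_of_in_tile by metis
  qed
  then show ?thesis unfolding disjoint_family_on_def by blast
qed

lemma bad_tile_determined:
  assumes "0 < n"
  shows "bad_tile n \<omega> z \<longleftrightarrow> bad_tile n (restrict \<omega> (tile_sites n z)) z"
proof -
  have odd: "restrict \<omega> (tile_sites n z) (odd_site (in_tile n z d)) = \<omega> (odd_site (in_tile n z d))"
    if "d \<in> {0..<2 * n} \<times> {0..<2 * n}" for d
    using that by (auto simp: tile_sites_def)
  have even: "restrict \<omega> (tile_sites n z) (even_site (in_tile n z d)) = \<omega> (even_site (in_tile n z d))"
    if "d \<in> {1..<2 * n} \<times> {1..<2 * n}" for d
    using that by (auto simp: tile_sites_def tile_interior_def)
  have "wall_tile n (restrict \<omega> (tile_sites n z)) z \<longleftrightarrow> wall_tile n \<omega> z"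
    unfolding wall_tile_def using odd by (intro ball_cong) auto
  moreover have "snare_tile n (restrict \<omega> (tile_sites n z)) z \<longleftrightarrow> snare_tile n \<omega> z"
    unfolding snare_tile_def
    using even odd half_subset[OF assms] by (intro conj_cong ball_cong bex_cong) (auto simp: subset_iff)
  ultimately show ?thesis by (simp add: bad_tile_def)
qed

context
  fixes p q :: real
  assumes p: "0 \<le> p" "p \<le> 1" and q: "0 \<le> q" "q \<le> 1"
begin

interpretation prob_space "closed_config p q"
  unfolding closed_config_def by (intro prob_space_PiM measure_pmf.prob_space_axioms)

lemma space_closed_config: "space (closed_config p q) = UNIV"
  unfolding closed_config_def by (rule space_PiM_pmf)

lemma closed_config_event:
  assumes "finite K" "\<And>\<omega>. E \<omega> \<longleftrightarrow> E (restrict \<omega> K)"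
  shows "{\<omega>. E \<omega>} \<in> events"
  unfolding closed_config_def using assms by (rule determined_event_measurable)

lemma prob_all_odd_sites_open:
  assumes "finite J"
  shows "prob {\<omega>. \<forall>f\<in>J. \<not> \<omega> (odd_site f)} = (1 - p) ^ card J"
proof -
  have "prob {\<omega>. \<forall>f\<in>J. \<not> \<omega> (odd_site f)} = prob {\<omega>. \<forall>v\<in>odd_site ` J. \<omega> v = False}" by simp
  also have "\<dots> = (\<Prod>v\<in>odd_site ` J. pmf (bernoulli_pmf (if odd_vertex v then p else q)) False)"
    unfolding closed_config_def using assms by (intro prob_cylinder) simp
  also have "\<dots> = (\<Prod>v\<in>odd_site ` J. 1 - p)"
    using p by (intro prod.cong) auto
  also have "\<dots> = (1 - p) ^ card J"
    by (simp add: card_image inj_on_def)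
  finally show ?thesis .
qed

lemma prob_even_site_closed: "prob {\<omega>. \<omega> (even_site a)} = q"
proof -
  have "prob {\<omega>. \<omega> (even_site a)} = prob {\<omega>. \<forall>v\<in>{even_site a}. \<omega> v = True}" by simp
  also have "\<dots> = q"
    unfolding closed_config_def using q by (subst prob_cylinder) auto
  finally show ?thesis .
qed

lemma prob_bad_tile_le_via_wall:
  assumes "0 < n"
  shows "prob {\<omega>. bad_tile n \<omega> z} \<le> 4 * (real_of_int n)\<^sup>2 * (1 - p)"
proof -
  let ?B = "{0..<2 * n} \<times> {0..<2 * n}"
  define U where "U d = {\<omega>. \<not> \<omega> (odd_site (in_tile n z d))}" for d
  have meas: "U d \<in> events" for d
    unfolding U_def by (rule closed_config_event[of "{odd_site (in_tile n z d)}"]) auto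
  have "prob {\<omega>. bad_tile n \<omega> z} \<le> prob (\<Union>d\<in>?B. U d)"
    by (rule finite_measure_mono) (auto simp: bad_tile_def wall_tile_def U_def intro: meas[unfolded U_def])
  also have "\<dots> \<le> (\<Sum>d\<in>?B. prob (U d))"
    by (rule finite_measure_subadditive_finite) (use meas in auto)
  also have "\<dots> = (\<Sum>d\<in>?B. 1 - p)"
    using prob_all_odd_sites_open[of "{in_tile n z d}" for d] by (simp add: U_def)
  also have "\<dots> = 4 * (real_of_int n)\<^sup>2 * (1 - p)"
    using assms by (simp add: card_cartesian_product power2_eq_square)
  finally show ?thesis .
qed

lemma prob_bad_tile_le_via_snare:
  assumes "0 < n"
  shows "prob {\<omega>. bad_tile n \<omega> z} \<le> 4 * (real_of_int n)\<^sup>2 * q + 4 * real_of_int n * (1 - p) ^ nat n"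
proof -
  let ?I = "{1..<2 * n} \<times> {1..<2 * n}"
  define C where "C d = {\<omega>. \<omega> (even_site (in_tile n z d))}" for d
  define H where "H k = {\<omega>. \<forall>f\<in>(\<lambda>a. in_tile n z (a, k)) ` half n (n \<le> k). \<not> \<omega> (odd_site f)}" for k
  define G where "G k = {\<omega>. \<forall>f\<in>(\<lambda>b. in_tile n z (k, b)) ` half n (k < n). \<not> \<omega> (odd_site f)}" for k
  have finh: "finite (half n up)" for up by (simp add: half_def)
  have cardh: "card (half n up) = nat n" for up by (simp add: half_def)
  have measC: "C d \<in> events" for d
    unfolding C_def by (rule closed_config_event[of "{even_site (in_tile n z d)}"]) auto
  have measH: "H k \<in> events" for k
    unfolding H_def
    by (rule closed_config_event[of "odd_site ` (\<lambda>a. in_tile n z (a, k)) ` half n (n \<le> k)"])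
       (simp_all add: finh)
  have measG: "G k \<in> events" for k
    unfolding G_def
    by (rule closed_config_event[of "odd_site ` (\<lambda>b. in_tile n z (k, b)) ` half n (k < n)"])
       (simp_all add: finh)
  have PH: "prob (H k) = (1 - p) ^ nat n" "prob (G k) = (1 - p) ^ nat n" for k
    unfolding H_def G_def
    by (subst prob_all_odd_sites_open; simp add: finh card_image inj_on_def cardh)+
  have sub: "prob (\<Union>i\<in>S. F i) \<le> real (card S) * b"
    if "finite S" "\<And>i. F i \<in> events" "\<And>i. prob (F i) = b" for S :: "'z set" and F b
  proof -
    have "prob (\<Union>i\<in>S. F i) \<le> (\<Sum>i\<in>S. prob (F i))"
      by (rule finite_measure_subadditive_finite) (use that in auto)
    then show ?thesis by (simp add: that(3))
  qed
  let ?C = "\<Union>d\<in>?I. C d" and ?H = "\<Union>k\<in>{0..<2 * n}. H k" and ?G = "\<Union>k\<in>{0..<2 * n}. G k"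
  have ev: "?C \<in> events" "?H \<in> events" "?G \<in> events"
    using measC measH measG by (auto intro!: sets.finite_UN)
  have "prob {\<omega>. bad_tile n \<omega> z} \<le> prob (?C \<union> (?H \<union> ?G))"
    by (rule finite_measure_mono) (use ev in \<open>auto simp: bad_tile_def snare_tile_def C_def H_def G_def\<close>)
  also have "\<dots> \<le> prob ?C + (prob ?H + prob ?G)"
    using measure_Un_le[OF ev(1) sets.Un[OF ev(2,3)]] measure_Un_le[OF ev(2,3)] by linarith
  also have "\<dots> \<le> 4 * (real_of_int n)\<^sup>2 * q + (2 * real_of_int n * (1 - p) ^ nat n + 2 * real_of_int n * (1 - p) ^ nat n)"
  proof (intro add_mono)
    have "prob ?C \<le> real (card ?I) * q"
      by (rule sub) (auto simp: measC, simp add: C_def prob_even_site_closed)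
    also have "real (card ?I) \<le> 4 * (real_of_int n)\<^sup>2"
    proof -
      have "card ?I \<le> card ({0..<2 * n} \<times> {0..<2 * n})" by (rule card_mono) auto
      also have "real (card ({0..<2 * n} \<times> {0..<2 * n})) = 4 * (real_of_int n)\<^sup>2"
        using assms by (simp add: card_cartesian_product power2_eq_square)
      finally show ?thesis by simp
    qed
    finally show "prob ?C \<le> 4 * (real_of_int n)\<^sup>2 * q"
      using q by (simp add: mult_right_mono)
    have "real (card {0..<2 * n}) = 2 * real_of_int n" using assms by simp
    then show "prob ?H \<le> 2 * real_of_int n * (1 - p) ^ nat n" "prob ?G \<le> 2 * real_of_int n * (1 - p) ^ nat n"
      using sub[of "{0..<2 * n}" H, OF _ measH PH(1)] sub[of "{0..<2 * n}" G, OF _ measG PH(2)] by simp_all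
  qed
  finally show ?thesis by simp
qed

lemma AE_no_draw:
  assumes n: "0 < n" and bad: "\<And>z. prob {\<omega>. bad_tile n \<omega> z} \<le> 1/16"
  shows "AE \<omega> in closed_config p q. \<forall>x. \<not> trap_draw z2_adj {v. \<not> \<omega> v} x"
proof -
  have "AE \<omega> in closed_config p q. finite {y. (bad_step n \<omega>)\<^sup>*\<^sup>* z y}" for z
    unfolding bad_step_def
  proof (rule AE_finite_cluster)
    show "{\<omega> \<in> space (closed_config p q). bad_tile n \<omega> y} \<in> events" for y
      using closed_config_event[OF finite_tile_sites, of "\<lambda>\<omega>. bad_tile n \<omega> y"] bad_tile_determined[OF n]
      by (simp add: space_closed_config)
    fix Z :: "(int \<times> int) set" assume "finite Z"
    then have "prob {\<omega>. \<forall>y\<in>Z. bad_tile n \<omega> y} = (\<Prod>y\<in>Z. prob {\<omega>. bad_tile n \<omega> y})"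
      unfolding closed_config_def
      using bad_tile_determined[OF n]
      by (intro prob_disjointly_determined_events[of Z "tile_sites n" "\<lambda>z \<omega>. bad_tile n \<omega> z"]
          finite_tile_sites disjoint_tile_sites)
    also have "\<dots> \<le> (\<Prod>y\<in>Z. 1/16)" using bad by (intro prod_mono) auto
    finally show "prob {\<omega> \<in> space (closed_config p q). \<forall>y\<in>Z. bad_tile n \<omega> y} \<le> (1/16) ^ card Z"
      by (simp add: space_closed_config)
  qed
  then have "AE \<omega> in closed_config p q. \<forall>z. finite {y. (bad_step n \<omega>)\<^sup>*\<^sup>* z y}"
    by (simp add: AE_all_countable)
  then show ?thesis
    by (rule AE_mp) (intro AE_I2 impI allI no_draw_if_bad_clusters_finite[OF n], erule spec)
qed

end

text \<open>
  The side \<open>n\<close> is about \<open>K * ln (1 / p) / p\<close> with \<open>K = 1282\<close>. The probability that one of the \<open>4 * n\<close>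
  half lines has no closed vertex is then of order \<open>p ^ K\<close> up to a factor \<open>n \<le> (K + 64) / p\<^sup>2\<close>, and
  \<open>(63/64) ^ (K - 2)\<close> is small enough to absorb the constants; the expected number of closed even
  vertices is of order \<open>n\<^sup>2 * q\<close>, which the choice \<open>c0 = 1 / (128 * (K + 64)\<^sup>2)\<close> keeps below \<open>1/32\<close>. The
  bound \<open>p \<le> 63/64\<close> gives \<open>1 \<le> 64 * ln (1 / p) / p\<close>, which absorbs the rounding of \<open>n\<close>.
\<close>

lemma scale_choice:
  fixes p q :: real
  assumes p: "0 < p" "p \<le> 63/64" and q: "0 \<le> q" "q < 1 / (128 * 1346\<^sup>2) * p\<^sup>2 / (ln (1 / p))\<^sup>2"
  obtains n :: int where "0 < n" "4 * (real_of_int n)\<^sup>2 * q + 4 * real_of_int n * (1 - p) ^ nat n \<le> 1/16"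
proof
  define L where "L = ln (1 / p)"
  define n where "n = \<lceil>1282 * (L / p)\<rceil>"
  have "ln p \<le> p - 1" using p by (intro ln_le_minus_one) auto
  then have L64: "1/64 \<le> L" using p by (simp add: L_def ln_div)
  have Lp: "L \<le> 1 / p" using p unfolding L_def by (intro order_trans[OF ln_le_minus_one]) auto
  have pos: "0 < 1282 * (L / p)" using L64 p by simp
  then show n: "0 < n" unfolding n_def by linarith
  have nL: "1282 * (L / p) \<le> real_of_int n" unfolding n_def by linarith
  have "1 \<le> 64 * (L / p)" using L64 p by (simp add: field_simps)
  then have nU: "real_of_int n \<le> 1346 * (L / p)" unfolding n_def by linarith
  have "(real_of_int n)\<^sup>2 * q \<le> (1346 * (L / p))\<^sup>2 * (1 / (128 * 1346\<^sup>2) * p\<^sup>2 / L\<^sup>2)"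
    using nU n q unfolding L_def[symmetric] by (intro mult_mono power_mono) auto
  also have "\<dots> = 1 / 128"
    using L64 p by (simp add: power_mult_distrib power_divide)
  finally have A: "4 * (real_of_int n)\<^sup>2 * q \<le> 1/32" by simp
  have "(1 - p) ^ nat n \<le> exp (- p) ^ nat n"
    using p exp_ge_add_one_self[of "- p"] by (intro power_mono) auto
  also have "\<dots> = exp (- (p * real_of_int n))"
    using n by (simp add: exp_of_nat_mult[symmetric] mult.commute)
  also have "\<dots> \<le> exp (- (1282 * L))" using nL p by (simp add: field_simps)
  also have "\<dots> = p ^ 1282"
  proof -
    have "exp (- (1282 * L)) = exp (- L) ^ 1282" by (simp add: exp_of_nat_mult[symmetric])
    also have "exp (- L) = p" using p by (simp add: L_def ln_div)
    finally show ?thesis .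
  qed
  finally have "real_of_int n * (1 - p) ^ nat n \<le> 1346 * (L / p) * p ^ 1282"
    using nU n p L64 by (intro mult_mono) auto
  also have "\<dots> \<le> 1346 * (1 / p / p) * p ^ 1282"
    using Lp p by (intro mult_right_mono mult_left_mono divide_right_mono) auto
  also have "\<dots> = 1346 * p ^ 1280"
  proof -
    have "p ^ 1282 = p ^ 1280 * p\<^sup>2" by (simp only: power_add[symmetric]) simp
    then show ?thesis using p by (simp add: power2_eq_square)
  qed
  also have "\<dots> \<le> 1346 * (63/64) ^ 1280"
    using p by (intro mult_left_mono power_mono) auto
  also have "(63/64 :: real) ^ 1280 = ((63/64) ^ 64) ^ 20" by (simp only: power_mult[symmetric]) simp
  also have "\<dots> \<le> (1/2) ^ 20"
    by (intro power_mono) (simp_all add: power_divide)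
  finally have B: "4 * real_of_int n * (1 - p) ^ nat n \<le> 1/32" by (simp add: power_divide)
  from A B show "4 * (real_of_int n)\<^sup>2 * q + 4 * real_of_int n * (1 - p) ^ nat n \<le> 1/16" by simp
qed

theorem corollary15:
  "\<exists>c0::real. c0 > 0 \<and>
     (\<forall>p q::real. 0 < p \<and> p < 1 \<and> 0 \<le> q \<and> q \<le> 1 \<and> q < c0 * p\<^sup>2 / (ln (1 / p))\<^sup>2 \<longrightarrow>
        (AE \<omega> in closed_config p q. \<forall>x. \<not> trap_draw z2_adj {v. \<not> \<omega> v} x))"
proof (intro exI[of _ "1 / (128 * 1346\<^sup>2)"] conjI allI impI)
  fix p q :: real
  assume "0 < p \<and> p < 1 \<and> 0 \<le> q \<and> q \<le> 1 \<and> q < 1 / (128 * 1346\<^sup>2) * p\<^sup>2 / (ln (1 / p))\<^sup>2"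
  then have p: "0 < p" "0 \<le> p" "p \<le> 1" and q: "0 \<le> q" "q \<le> 1"
    and q_small: "q < 1 / (128 * 1346\<^sup>2) * p\<^sup>2 / (ln (1 / p))\<^sup>2"
    by auto
  \<comment> \<open>Above \<open>63/64\<close> the four squares of a tile with \<open>n = 1\<close> are all closed with probability at least
    \<open>15/16\<close>, whatever \<open>q\<close> is.\<close>
  show "AE \<omega> in closed_config p q. \<forall>x. \<not> trap_draw z2_adj {v. \<not> \<omega> v} x"
  proof (cases "p \<le> 63/64")
    case True
    obtain n :: int where n: "0 < n"
      "4 * (real_of_int n)\<^sup>2 * q + 4 * real_of_int n * (1 - p) ^ nat n \<le> 1/16"
      using scale_choice[OF p(1) True q(1) q_small] by blast
    show ?thesis
      using prob_bad_tile_le_via_snare[OF p(2,3) q n(1)] n(2)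
      by (intro AE_no_draw[OF p(2,3) q n(1)]) (rule order_trans)
  next
    case False
    then have "4 * (real_of_int 1)\<^sup>2 * (1 - p) \<le> 1/16" by simp
    then show ?thesis
      by (intro AE_no_draw[OF p(2,3) q zero_less_one]
          order_trans[OF prob_bad_tile_le_via_wall[OF p(2,3) q zero_less_one]])
  qed
qed simp

end
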